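(* Not all cobweb-admissible sequences are cobweb tiling sequences; that is, there exists a cobweb-admissible sequence $F=\{n_F\}_{n\ge 0}$ and integers $0\le k<n$ such that the layer $\langle \Phi_{k+1}\to\Phi_n\rangle$ of the cobweb poset of $F$ admits no partition into max-disjoint blocks of the form $\sigma P_m$, $m=n-k$.
   Context: Let $F=\{n_F\}_{n\ge0}$ be a sequence of positive integers with $0_F=1$. Define $n_F!=1_F\cdot 2_F\cdots n_F$ ($0_F!=1$), $n_F^{\underline{k}}=n_F(n-1)_F\cdots(n-k+1)_F$, and the $F$-nomial coefficients $\binom{n}{k}_F=\frac{n_F^{\underline{k}}}{k_F!}$. The sequence $F$ is called cobweb-admissible if $\binom{n}{k}_F$ is a nonnegative integer for all integers $n,k\ge0$ (with $\binom{n}{k}_F=0$ for $k>n$). The cobweb poset of $F$ is the graded poset whose vertex set is a disjoint union of levels $\Phi_s$, $s\ge 0$, with $|\Phi_s|=s_F$, and in which $x<y$ whenever $x\in\Phi_r$, $y\in\Phi_s$ with $r<s$ (so every vertex of $\Phi_s$ is covered by every vertex of $\Phi_{s+1}$). For $k<n$ the layer $\langle\Phi_{k+1}\to\Phi_n\rangle$ is the subposet on $\Phi_{k+1}\cup\dots\cup\Phi_n$; its maximal chains are the tuples $(x_{k+1},\dots,x_n)$ with $x_s\in\Phi_s$. With $m=n-k$, a block of the form $\sigma P_m$ in this layer is a subposet on $V_{k+1}\cup\dots\cup V_n$ with $V_s\subseteq\Phi_s$ such that $(|V_{k+1}|,\dots,|V_n|)$ is a permutation $\sigma$ of $(1_F,2_F,\dots,m_F)$;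 its set of maximal chains is $V_{k+1}\times\dots\times V_n$. Two blocks are max-disjoint if they have no maximal chain in common. A partition (tiling) of the layer by max-disjoint blocks $\sigma P_m$ is a family of such blocks whose sets of maximal chains partition the set of all maximal chains of the layer. A cobweb-admissible sequence is a cobweb tiling sequence if every layer $\langle\Phi_{k+1}\to\Phi_n\rangle$, $0\le k<n$, of its cobweb poset admits such a partition. *)

theory Defs
  imports Complex_Main "HOL-Library.FuncSet" "HOL-Combinatorics.Permutations"
begin

definition F_fact :: "(nat \<Rightarrow> nat) \<Rightarrow> nat \<Rightarrow> nat" where
  "F_fact F n = (\<Prod>i=1..n. F i)"

text \<open>For \<open>k > n\<close> the truncated subtraction makes this product meaningless; it is only used
  for \<open>k \<le> n\<close>.\<close>

definition F_falling :: "(nat \<Rightarrow> nat) \<Rightarrow> nat \<Rightarrow> nat \<Rightarrow> nat" where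
  "F_falling F n k = (\<Prod>i<k. F (n - i))"

definition F_nomial :: "(nat \<Rightarrow> nat) \<Rightarrow> nat \<Rightarrow> nat \<Rightarrow> rat" where
  "F_nomial F n k = (if k \<le> n then of_nat (F_falling F n k) / of_nat (F_fact F k) else 0)"

definition cobweb_admissible :: "(nat \<Rightarrow> nat) \<Rightarrow> bool" where
  "cobweb_admissible F \<longleftrightarrow> (\<forall>n. F n > 0) \<and> F 0 = 1 \<and> (\<forall>n k. F_nomial F n k \<in> \<nat>)"

text \<open>A vertex is a pair of its level and its position in that level.\<close>

definition level :: "(nat \<Rightarrow> nat) \<Rightarrow> nat \<Rightarrow> (nat \<times> nat) set" where
  "level F s = {s} \<times> {..<F s}"

definition cobweb_less :: "nat \<times> nat \<Rightarrow> nat \<times> nat \<Rightarrow> bool" where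
  "cobweb_less x y \<longleftrightarrow> fst x < fst y"

text \<open>The subposet on \<open>\<Phi>\<^sub>k\<^sub>+\<^sub>1 \<union> \<dots> \<union> \<Phi>\<^sub>n\<close>; all subposets carry the order \<open>cobweb_less\<close> and are given by
  their vertex sets.\<close>

definition layer :: "(nat \<Rightarrow> nat) \<Rightarrow> nat \<Rightarrow> nat \<Rightarrow> (nat \<times> nat) set" where
  "layer F k n = (\<Union>s\<in>{k+1..n}. level F s)"

definition max_chains :: "(nat \<times> nat) set \<Rightarrow> (nat \<times> nat) set set" where
  "max_chains W = {C. pred_on.maxchain W cobweb_less C}"

definition is_block :: "(nat \<Rightarrow> nat) \<Rightarrow> nat \<Rightarrow> nat \<Rightarrow> (nat \<times> nat) set \<Rightarrow> bool" where
  "is_block F k n W \<longleftrightarrow>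
     (\<exists>V \<sigma>. (\<forall>s\<in>{k+1..n}. V s \<subseteq> level F s) \<and>
            \<sigma> permutes {1..n-k} \<and>
            (\<forall>i\<in>{1..n-k}. card (V (k + i)) = F (\<sigma> i)) \<and>
            W = (\<Union>s\<in>{k+1..n}. V s))"

definition max_disjoint :: "(nat \<times> nat) set \<Rightarrow> (nat \<times> nat) set \<Rightarrow> bool" where
  "max_disjoint W W' \<longleftrightarrow> max_chains W \<inter> max_chains W' = {}"

definition is_tiling :: "(nat \<Rightarrow> nat) \<Rightarrow> nat \<Rightarrow> nat \<Rightarrow> (nat \<times> nat) set set \<Rightarrow> bool" where
  "is_tiling F k n \<B> \<longleftrightarrow>
     (\<forall>W\<in>\<B>. is_block F k n W) \<and>
     pairwise max_disjoint \<B> \<and>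
     (\<Union>W\<in>\<B>. max_chains W) = max_chains (layer F k n)"

definition cobweb_tiling :: "(nat \<Rightarrow> nat) \<Rightarrow> bool" where
  "cobweb_tiling F \<longleftrightarrow>
     cobweb_admissible F \<and> (\<forall>k n. k < n \<longrightarrow> (\<exists>\<B>. is_tiling F k n \<B>))"

text \<open>The maximal chains are exactly the ranges of the tuples \<open>(x\<^sub>k\<^sub>+\<^sub>1, \<dots>, x\<^sub>n)\<close> with \<open>x\<^sub>s \<in> V s\<close>.
  This covers layers and, for admissible \<open>F\<close>, blocks.\<close>

lemma max_chains_levelwise:
  assumes sub: "\<And>s. s \<in> S \<Longrightarrow> V s \<subseteq> level F s" and ne: "\<And>s. s \<in> S \<Longrightarrow> V s \<noteq> {}"
  shows "max_chains (\<Union>s\<in>S. V s) = (\<lambda>x. x ` S) ` (PiE S V)"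
proof (intro equalityI subsetI)
  let ?W = "\<Union>s\<in>S. V s"
  interpret pred_on ?W cobweb_less .
  have fstV: "fst v = s" if "s \<in> S" "v \<in> V s" for s v
    using sub[OF that(1)] that(2) by (auto simp: level_def)
  fix C assume "C \<in> max_chains ?W"
  then have mc: "maxchain C" by (simp add: max_chains_def)
  then have ch: "chain C" and CW: "C \<subseteq> ?W" by (auto simp: maxchain_def chain_def)
  have inj: "v = w" if "v \<in> C" "w \<in> C" "fst v = fst w" for v w
    using ch that unfolding chain_def cobweb_less_def by fastforce
  have ex: "\<exists>v\<in>C. fst v = s" if s: "s \<in> S" for s
  proof (rule ccontr)
    assume no: "\<not> ?thesis"
    obtain v where v: "v \<in> V s" using ne[OF s] by auto
    have "v \<notin> C" using no fstV[OF s v] by auto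
    moreover have "chain (insert v C)"
      unfolding chain_def
    proof (intro conjI ballI)
      show "insert v C \<subseteq> ?W" using CW s v by auto
      fix a b assume "a \<in> insert v C" "b \<in> insert v C"
      then show "cobweb_less\<^sup>=\<^sup>= a b \<or> cobweb_less\<^sup>=\<^sup>= b a"
        using ch no fstV[OF s v] by (auto simp: chain_def cobweb_less_def)
    qed
    ultimately show False using mc by (auto simp: maxchain_def)
  qed
  then obtain x where x: "\<And>s. s \<in> S \<Longrightarrow> x s \<in> C \<and> fst (x s) = s" by metis
  have xV: "x s \<in> V s" if "s \<in> S" for s
    using x[OF that] CW fstV by fastforce
  have "C = restrict x S ` S"
  proof (intro equalityI subsetI)
    fix v assume v: "v \<in> C"
    then obtain s where "s \<in> S" "v \<in> V s" using CW by auto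
    then show "v \<in> restrict x S ` S"
      using inj[OF v, of "x s"] x[of s] fstV[of s v] by (auto intro!: image_eqI[of _ _ s])
  qed (use x in auto)
  then show "C \<in> (\<lambda>x. x ` S) ` PiE S V" using xV by (intro image_eqI[of _ _ "restrict x S"]) auto
next
  let ?W = "\<Union>s\<in>S. V s"
  interpret pred_on ?W cobweb_less .
  have fstV: "fst v = s" if "s \<in> S" "v \<in> V s" for s v
    using sub[OF that(1)] that(2) by (auto simp: level_def)
  fix C assume "C \<in> (\<lambda>x. x ` S) ` (PiE S V)"
  then obtain x where x: "x \<in> PiE S V" and C: "C = x ` S" by auto
  have xs: "x s \<in> V s" "fst (x s) = s" if "s \<in> S" for s using x fstV that by (auto simp: PiE_mem)
  have "chain C"
    unfolding chain_def
  proof (intro conjI ballI)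
    show "C \<subseteq> ?W" using C xs by auto
    fix a b assume "a \<in> C" "b \<in> C"
    then obtain s t where st: "s \<in> S" "t \<in> S" "a = x s" "b = x t" using C by auto
    show "cobweb_less\<^sup>=\<^sup>= a b \<or> cobweb_less\<^sup>=\<^sup>= b a"
      using st xs(2)[of s] xs(2)[of t] by (cases s t rule: linorder_cases) (auto simp: cobweb_less_def)
  qed
  moreover have False if D: "chain D" "C \<subset> D" for D
  proof -
    obtain v where v: "v \<in> D" "v \<notin> C" using D by auto
    then obtain s where s: "s \<in> S" "v \<in> V s" using D(1) unfolding chain_def by blast
    then have "x s \<in> D" "fst (x s) = fst v" "x s \<noteq> v" using xs fstV C D v by auto
    then show False using D(1) v(1) unfolding chain_def cobweb_less_def by fastforce
  qed
  ultimately show "C \<in> max_chains ?W" by (auto simp: max_chains_def maxchain_def)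
qed

end

theory Submission
  imports Defs
begin

text \<open>
  The witness is the sequence \<open>1, 1, 4, 2, 2, 2, \<dots>\<close>. As \<open>0\<^sub>F! = 1\<^sub>F! = 1\<close> and \<open>n\<^sub>F! = 2\<^sup>n\<close> for
  \<open>n \<ge> 2\<close>, its \<open>F\<close>-nomial coefficients \<open>n\<^sub>F! / (k\<^sub>F! (n - k)\<^sub>F!)\<close> with \<open>k \<le> n\<close> are all 1, 2 or 4.
  For \<open>m \<ge> 2\<close>, a block \<open>\<sigma>P\<^sub>m\<close> has \<open>2\<^sub>F = 4\<close> vertices on one of its levels, but the levels from 3
  on have only two. So no such block fits into a layer above level 2, although the layer has
  maximal chains to be covered.
\<close>

lemma F_fact_Suc: "F_fact F (Suc n) = F_fact F n * F (Suc n)"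
  by (simp add: F_fact_def)

lemma F_fact_pos:
  assumes "\<And>i. i \<in> {1..n} \<Longrightarrow> F i > 0"
  shows "F_fact F n > 0"
  unfolding F_fact_def using assms by (intro prod_pos)

lemma F_falling_Suc_Suc: "F_falling F (Suc n) (Suc k) = F (Suc n) * F_falling F n k"
  by (simp add: F_falling_def prod.lessThan_Suc_shift del: prod.lessThan_Suc)

lemma F_fact_mult_F_falling: "F_fact F m * F_falling F (m + k) k = F_fact F (m + k)"
proof (induction k)
  case 0
  show ?case by (simp add: F_falling_def)
next
  case (Suc k)
  then show ?case by (simp add: F_falling_Suc_Suc F_fact_Suc)
qed

lemma F_nomial_in_Nats:
  assumes pos: "\<And>n. F n > 0" and dvd: "\<And>m. F_fact F m * F_fact F k dvd F_fact F (m + k)"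
  shows "F_nomial F n k \<in> \<nat>"
proof (cases "k \<le> n")
  case True
  define m where "m = n - k"
  have n: "n = m + k"
    using True by (simp add: m_def)
  obtain c where "F_fact F (m + k) = F_fact F m * F_fact F k * c"
    using dvd by (auto elim: dvdE)
  then have "F_fact F m * F_falling F n k = F_fact F m * (F_fact F k * c)"
    by (simp add: n F_fact_mult_F_falling)
  then have "F_falling F n k = F_fact F k * c"
    using F_fact_pos[of m F] pos by simp
  then have "F_nomial F n k = of_nat c"
    using True F_fact_pos[of k F] pos by (simp add: F_nomial_def)
  then show ?thesis by simp
qed (simp add: F_nomial_def)

lemma max_chains_layer_nonempty:
  assumes "\<And>s. s \<in> {k+1..n} \<Longrightarrow> F s > 0"
  shows "max_chains (layer F k n) \<noteq> {}"
proof -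
  have "level F s \<noteq> {}" if "s \<in> {k+1..n}" for s
    using assms[OF that] by (auto simp: level_def)
  then show ?thesis
    unfolding layer_def by (subst max_chains_levelwise) (auto simp: PiE_eq_empty_iff)
qed

lemma is_block_le_level_size:
  assumes "is_block F k n W" and i: "i \<in> {1..n-k}"
  obtains s where "s \<in> {k+1..n}" "F i \<le> F s"
proof -
  obtain V \<sigma> where V: "\<And>s. s \<in> {k+1..n} \<Longrightarrow> V s \<subseteq> level F s"
    and \<sigma>: "\<sigma> permutes {1..n-k}"
    and card_V: "\<And>j. j \<in> {1..n-k} \<Longrightarrow> card (V (k + j)) = F (\<sigma> j)"
    using assms(1) unfolding is_block_def by blast
  obtain j where j: "j \<in> {1..n-k}" "i = \<sigma> j"
    using i permutes_image[OF \<sigma>] by blast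
  then have level_j: "k + j \<in> {k+1..n}" by auto
  have "F i = card (V (k + j))"
    using card_V j by simp
  also have "\<dots> \<le> card (level F (k + j))"
    using V[OF level_j] by (intro card_mono) (auto simp: level_def)
  also have "\<dots> = F (k + j)"
    by (simp add: level_def)
  finally show thesis
    using that level_j by blast
qed

lemma is_tiling_le_level_size:
  assumes "is_tiling F k n \<B>" and "\<And>s. s \<in> {k+1..n} \<Longrightarrow> F s > 0" and "i \<in> {1..n-k}"
  obtains s where "s \<in> {k+1..n}" "F i \<le> F s"
proof -
  have "max_chains (layer F k n) \<noteq> {}"
    using assms(2) by (rule max_chains_layer_nonempty)
  then obtain W where "W \<in> \<B>"
    using assms(1) by (auto simp: is_tiling_def)
  then have "is_block F k n W"
    using assms(1) by (simp add: is_tiling_def)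
  then show thesis
    using is_block_le_level_size assms(3) that by blast
qed

definition front_loaded :: "nat \<Rightarrow> nat" where
  "front_loaded n = (if n < 2 then 1 else if n = 2 then 4 else 2)"

lemma front_loaded_pos: "front_loaded n > 0"
  by (simp add: front_loaded_def)

lemma F_fact_front_loaded: "F_fact front_loaded n = (if n < 2 then 1 else 2 ^ n)"
proof (induction n)
  case 0
  show ?case by (simp add: F_fact_def)
next
  case (Suc n)
  then show ?case
    by (auto simp: F_fact_Suc front_loaded_def less_2_cases_iff not_less le_Suc_eq)
qed

lemma cobweb_admissible_front_loaded: "cobweb_admissible front_loaded"
proof -
  have "F_fact front_loaded m * F_fact front_loaded k dvd F_fact front_loaded (m + k)" for m k
    by (auto simp: F_fact_front_loaded less_2_cases_iff power_add)
  then have "F_nomial front_loaded n k \<in> \<nat>" for n k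
    using F_nomial_in_Nats front_loaded_pos by blast
  then show ?thesis
    using front_loaded_pos by (simp add: cobweb_admissible_def front_loaded_def)
qed

lemma not_is_tiling_front_loaded:
  assumes "2 \<le> k" "k + 2 \<le> n"
  shows "\<not> is_tiling front_loaded k n \<B>"
proof
  assume "is_tiling front_loaded k n \<B>"
  moreover have "2 \<in> {1..n-k}"
    using assms(2) by simp
  ultimately obtain s where "s \<in> {k+1..n}" "front_loaded 2 \<le> front_loaded s"
    using is_tiling_le_level_size front_loaded_pos by blast
  then show False
    using assms(1) by (simp add: front_loaded_def)
qed

theorem theorem3:
  "\<not> (\<forall>F. cobweb_admissible F \<longrightarrow> cobweb_tiling F) \<and>
   (\<exists>F k n. cobweb_admissible F \<and> k < n \<and> \<not> (\<exists>\<B>. is_tiling F k n \<B>))"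
proof -
  have "\<not> (\<exists>\<B>. is_tiling front_loaded 2 4 \<B>)"
    using not_is_tiling_front_loaded by simp
  then have "\<exists>F k n. cobweb_admissible F \<and> k < n \<and> \<not> (\<exists>\<B>. is_tiling F k n \<B>)"
    using cobweb_admissible_front_loaded
    by (intro exI[of _ front_loaded] exI[of _ 2] exI[of _ 4]) simp
  then show ?thesis
    unfolding cobweb_tiling_def by blast
qed

end
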